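(* For every odd $n\in\mathbb{Z}_{>0}$ there exist a graph $G=(V,E)$ on $n$ vertices and a family $\mathcal{F}$ of facets of $P^{\uparrow}_{\mathrm{odd}}(G)$ whose size is exponential in $n$, with the following property: for every $F\in\mathcal{F}$ and all $a\in\mathbb{Z}^E$, $b\in\mathbb{Z}$ such that $F=\{x\in P^{\uparrow}_{\mathrm{odd}}(G)\colon a^\top x=b\}$, we have \[ \max_{e\in E}|a_e|\ \ge\ n-4\qquad\text{and}\qquad\bigl|\{a_e\colon e\in E\}\bigr|\ \ge\ \frac{n-3}{2}\,. \]
   Context: For a graph $G=(V,E)$, the odd cycle polytope is $P_{\mathrm{odd}}(G)=\operatorname{conv}\{\chi^C\colon C\subseteq E \text{ an odd cycle of } G\}$ (with $\chi^C$ the incidence vector), and its dominant is the Minkowski sum $P^{\uparrow}_{\mathrm{odd}}(G)=P_{\mathrm{odd}}(G)+\mathbb{R}^E_{\ge0}$. *)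

theory Defs
  imports "HOL-Analysis.Analysis"
begin

text \<open>Simple graphs: vertex set {0..<n}, edges are 2-element vertex sets.
  Vectors in R^E are functions (nat set => real) that vanish outside E.\<close>

definition simple_graph :: "nat \<Rightarrow> nat set set \<Rightarrow> bool" where
  "simple_graph n E \<longleftrightarrow> E \<subseteq> {{u, v} | u v. u \<noteq> v \<and> u < n \<and> v < n}"

definition is_cycle :: "nat set set \<Rightarrow> nat set set \<Rightarrow> bool" where
  "is_cycle E C \<longleftrightarrow> C \<subseteq> E \<and> (\<exists>vs. length vs \<ge> 3 \<and> distinct vs \<and>
      C = {{vs ! i, vs ! ((i + 1) mod length vs)} | i. i < length vs})"

definition odd_cycles :: "nat set set \<Rightarrow> nat set set set" where
  "odd_cycles E = {C. is_cycle E C \<and> odd (card C)}"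

definition incidence :: "nat set set \<Rightarrow> (nat set \<Rightarrow> real)" where
  "incidence C = (\<lambda>e. if e \<in> C then 1 else 0)"

definition conv_fin :: "(nat set \<Rightarrow> real) set \<Rightarrow> (nat set \<Rightarrow> real) set" where
  "conv_fin A = {x. \<exists>u. (\<forall>y\<in>A. u y \<ge> 0) \<and> sum u A = 1 \<and>
                      x = (\<lambda>e. \<Sum>y\<in>A. u y * y e)}"

definition odd_cycle_polytope :: "nat set set \<Rightarrow> (nat set \<Rightarrow> real) set" where
  "odd_cycle_polytope E = conv_fin (incidence ` odd_cycles E)"

definition dominant :: "nat set set \<Rightarrow> (nat set \<Rightarrow> real) set \<Rightarrow> (nat set \<Rightarrow> real) set" where
  "dominant E P = {x. \<exists>p\<in>P. \<exists>r. (\<forall>e\<in>E. r e \<ge> 0) \<and> (\<forall>e. e \<notin> E \<longrightarrow> r e = 0) \<and>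
                        x = (\<lambda>e. p e + r e)}"

definition odd_cycle_dominant :: "nat set set \<Rightarrow> (nat set \<Rightarrow> real) set" where
  "odd_cycle_dominant E = dominant E (odd_cycle_polytope E)"

definition face_E :: "nat set set \<Rightarrow> (nat set \<Rightarrow> real) set \<Rightarrow> (nat set \<Rightarrow> real) set \<Rightarrow> bool" where
  "face_E E P F \<longleftrightarrow> (\<exists>a b. (\<forall>x\<in>P. (\<Sum>e\<in>E. a e * x e) \<le> b) \<and>
                           F = {x\<in>P. (\<Sum>e\<in>E. a e * x e) = b})"

definition aff_indep_E :: "nat set set \<Rightarrow> (nat set \<Rightarrow> real) set \<Rightarrow> bool" where
  "aff_indep_E E T \<longleftrightarrow> finite T \<and> (\<forall>u. sum u T = 0 \<and> (\<forall>e\<in>E. (\<Sum>t\<in>T. u t * t e) = 0)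
                                         \<longrightarrow> (\<forall>t\<in>T. u t = 0))"

definition dim_E :: "nat set set \<Rightarrow> (nat set \<Rightarrow> real) set \<Rightarrow> int" where
  "dim_E E S = int (Max {card T | T. T \<subseteq> S \<and> aff_indep_E E T}) - 1"

definition facet_E :: "nat set set \<Rightarrow> (nat set \<Rightarrow> real) set \<Rightarrow> (nat set \<Rightarrow> real) set \<Rightarrow> bool" where
  "facet_E E P F \<longleftrightarrow> face_E E P F \<and> F \<noteq> {} \<and> dim_E E F = dim_E E P - 1"

end

theory Submission
  imports Defs
begin

text \<open>Take the complete graph on an odd cycle with \<open>m = n - 2\<close> vertices together with two further
  vertices \<open>x\<close>, \<open>y\<close>. Give a pair of cycle vertices the length of the odd arc between them, the
  edge \<open>xy\<close> weight 1, and all edges from \<open>x\<close> or \<open>y\<close> to the cycle weight \<open>(m - 1) / 2\<close>. Distances in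
  the bipartite double cover show that every odd cycle has weight at least \<open>m\<close>. The odd cycles of
  weight \<open>m\<close> determine the weights: triangles through \<open>x\<close> and \<open>y\<close> force all cycle edges to have
  equal coefficients, and triangles and pentagons with odd gaps then fix the chords. So this is a
  facet, and its coefficients include \<open>1, 3, \<dots>, m - 2\<close>. Swapping the first two vertices in any set of
  disjoint consecutive triples of the cycle yields \<open>2 ^ (m div 3)\<close> different facets.\<close>

section \<open>Facets from tight odd cycles\<close>

lemma homogeneous_system_nontrivial_solution:
  fixes A :: "'s \<Rightarrow> 't \<Rightarrow> real"
  assumes "finite S" "finite T" "card S < card T"
  shows "\<exists>u. (\<exists>t\<in>T. u t \<noteq> 0) \<and> (\<forall>s\<in>S. (\<Sum>t\<in>T. u t * A s t) = 0)"
  using assms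
proof (induction S arbitrary: T A rule: finite_induct)
  case empty
  then have "T \<noteq> {}" by auto
  then show ?case by (intro exI[of _ "\<lambda>_. 1"]) auto
next
  case (insert s S)
  show ?case
  proof (cases "\<forall>t\<in>T. A s t = 0")
    case True
    obtain u where u: "\<exists>t\<in>T. u t \<noteq> 0" "\<forall>s\<in>S. (\<Sum>t\<in>T. u t * A s t) = 0"
      using insert.IH[of T A] insert.prems insert.hyps by auto
    moreover have "(\<Sum>t\<in>T. u t * A s t) = 0"
      using True by (intro sum.neutral) auto
    ultimately show ?thesis by auto
  next
    case False
    \<comment> \<open>Gaussian elimination with pivot \<open>t0\<close>: the modified coefficients
      below arise by eliminating \<open>t0\<close> through equation \<open>s\<close>, and
      \<open>c\<close> is the back-substituted value of that unknown.\<close>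
    then obtain t0 where t0: "t0 \<in> T" "A s t0 \<noteq> 0" by auto
    define T' where "T' = T - {t0}"
    have T: "T = insert t0 T'" "t0 \<notin> T'" "finite T'"
      using t0 insert.prems by (auto simp: T'_def)
    have "card S < card T'"
      using insert.prems insert.hyps T by simp
    then obtain u where u: "\<exists>t\<in>T'. u t \<noteq> 0"
        "\<forall>s'\<in>S. (\<Sum>t\<in>T'. u t * (A s' t - A s t * A s' t0 / A s t0)) = 0"
      using insert.IH[of T' "\<lambda>s' t. A s' t - A s t * A s' t0 / A s t0"] T by auto
    define c where "c = - (\<Sum>t\<in>T'. u t * A s t) / A s t0"
    define v where "v = u(t0 := c)"
    have split: "(\<Sum>t\<in>T. v t * A s' t) = c * A s' t0 + (\<Sum>t\<in>T'. u t * A s' t)" for s'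
    proof -
      have "(\<Sum>t\<in>T'. v t * A s' t) = (\<Sum>t\<in>T'. u t * A s' t)"
        using T by (intro sum.cong) (auto simp: v_def)
      then show ?thesis using T by (simp add: v_def)
    qed
    have "(\<Sum>t\<in>T. v t * A s t) = 0"
      unfolding split c_def using t0 by simp
    moreover have "(\<Sum>t\<in>T. v t * A s' t) = 0" if "s' \<in> S" for s'
    proof -
      have "0 = (\<Sum>t\<in>T'. u t * A s' t - (u t * A s t) * (A s' t0 / A s t0))"
        using u(2) that by (simp add: algebra_simps)
      also have "\<dots> = (\<Sum>t\<in>T'. u t * A s' t) - (\<Sum>t\<in>T'. u t * A s t) * (A s' t0 / A s t0)"
        by (simp only: sum_subtractf sum_distrib_right)
      finally show ?thesis unfolding split c_def by simp
    qed
    moreover have "\<exists>t\<in>T. v t \<noteq> 0"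
      using u(1) T by (auto simp: v_def)
    ultimately show ?thesis by auto
  qed
qed

definition lin_indep_E :: "nat set set \<Rightarrow> (nat set \<Rightarrow> real) set \<Rightarrow> bool" where
  "lin_indep_E E T \<longleftrightarrow> finite T \<and>
     (\<forall>u. (\<forall>e\<in>E. (\<Sum>t\<in>T. u t * t e) = 0) \<longrightarrow> (\<forall>t\<in>T. u t = 0))"

lemma lin_indep_E_card_le:
  assumes "finite E" "lin_indep_E E T"
  shows "card T \<le> card E"
proof (rule ccontr)
  assume "\<not> card T \<le> card E"
  then show False
    using homogeneous_system_nontrivial_solution[of E T "\<lambda>e t. t e"] assms
    unfolding lin_indep_E_def by fastforce
qed

lemma lin_indep_E_imp_aff_indep_E: "lin_indep_E E T \<Longrightarrow> aff_indep_E E T"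
  unfolding lin_indep_E_def aff_indep_E_def by blast

lemma aff_indep_E_card_le:
  assumes "finite E" "aff_indep_E E T"
  shows "card T \<le> card E + 1"
proof (rule ccontr)
  assume "\<not> card T \<le> card E + 1"
  \<comment> \<open>\<open>None\<close> indexes the extra equation that the coefficients sum to
    zero; \<open>Some e\<close> indexes coordinate \<open>e\<close>.\<close>
  then have "card (insert None (Some ` E)) < card T"
    using assms by (simp add: card_image)
  then obtain u where u: "\<exists>t\<in>T. u t \<noteq> 0"
    "\<forall>s\<in>insert None (Some ` E). (\<Sum>t\<in>T. u t * (case s of None \<Rightarrow> 1 | Some e \<Rightarrow> t e)) = 0"
    using homogeneous_system_nontrivial_solution
      [of "insert None (Some ` E)" T "\<lambda>s t. case s of None \<Rightarrow> 1 | Some e \<Rightarrow> t e"]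
      assms unfolding aff_indep_E_def by auto
  then show False
    using assms(2) unfolding aff_indep_E_def by auto
qed

text \<open>Take a largest independent \<open>T\<close> inside \<open>S\<close>. If it were too
  small, some nonzero \<open>a\<close> would annihilate \<open>T\<close>; by maximality every
  \<open>s\<close> in \<open>S\<close> depends on \<open>T\<close>, so \<open>a\<close> would
  annihilate \<open>S\<close> as well.\<close>

lemma exists_lin_indep_E_card_eq:
  assumes fin: "finite E"
    and ann: "\<And>a. (\<And>s. s \<in> S \<Longrightarrow> (\<Sum>e\<in>E. a e * s e) = 0) \<Longrightarrow> \<forall>e\<in>E. a e = 0"
  shows "\<exists>T\<subseteq>S. lin_indep_E E T \<and> card T = card E"
proof -
  let ?P = "\<lambda>k. \<exists>T\<subseteq>S. lin_indep_E E T \<and> card T = k"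
  have "?P 0" by (intro exI[of _ "{}"]) (auto simp: lin_indep_E_def)
  moreover have bound: "\<forall>k. ?P k \<longrightarrow> k \<le> card E"
    using lin_indep_E_card_le[OF fin] by auto
  ultimately obtain k where k: "?P k" "\<forall>k'. ?P k' \<longrightarrow> k' \<le> k"
    using GreatestI_nat[of ?P 0 "card E"] Greatest_le_nat[of ?P _ "card E"] by blast
  then obtain T where T: "T \<subseteq> S" "lin_indep_E E T" "card T = k" by auto
  have finT: "finite T" using T by (simp add: lin_indep_E_def)
  have "card T = card E"
  proof (rule ccontr)
    assume "card T \<noteq> card E"
    then have "card T < card E" using lin_indep_E_card_le[OF fin T(2)] by simp
    then obtain a where a: "\<exists>e\<in>E. a e \<noteq> 0" "\<forall>t\<in>T. (\<Sum>e\<in>E. a e * t e) = 0"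
      using homogeneous_system_nontrivial_solution[of T E "\<lambda>t e. t e"] fin finT by auto
    have "(\<Sum>e\<in>E. a e * s e) = 0" if s: "s \<in> S" for s
    proof (cases "s \<in> T")
      case True
      then show ?thesis using a by auto
    next
      case False
      have "\<not> lin_indep_E E (insert s T)"
      proof
        assume "lin_indep_E E (insert s T)"
        then have "?P (Suc k)"
          using T s False finT by (intro exI[of _ "insert s T"]) auto
        then show False using k(2) by fastforce
      qed
      then obtain u where u: "\<forall>e\<in>E. (\<Sum>t\<in>insert s T. u t * t e) = 0" "\<exists>t\<in>insert s T. u t \<noteq> 0"
        using finT unfolding lin_indep_E_def by auto
      have eq: "u s * s e = - (\<Sum>t\<in>T. u t * t e)" if "e \<in> E" for e
        using u(1) that finT False by (simp add: eq_neg_iff_add_eq_0)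
      have us: "u s \<noteq> 0"
      proof
        assume "u s = 0"
        then have "\<forall>e\<in>E. (\<Sum>t\<in>T. u t * t e) = 0" using eq by simp
        then have "\<forall>t\<in>T. u t = 0" using T(2) unfolding lin_indep_E_def by blast
        then show False using u(2) \<open>u s = 0\<close> by auto
      qed
      have "u s * (\<Sum>e\<in>E. a e * s e) = (\<Sum>e\<in>E. a e * (u s * s e))"
        by (simp add: sum_distrib_left mult.left_commute)
      also have "\<dots> = (\<Sum>e\<in>E. \<Sum>t\<in>T. - (u t * (a e * t e)))"
        by (intro sum.cong refl)
          (simp add: eq sum_distrib_left sum_negf mult.left_commute)
      also have "\<dots> = (\<Sum>t\<in>T. \<Sum>e\<in>E. - (u t * (a e * t e)))"
        by (rule sum.swap)
      also have "\<dots> = (\<Sum>t\<in>T. - (u t * (\<Sum>e\<in>E. a e * t e)))"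
        by (simp add: sum_distrib_left sum_negf)
      also have "\<dots> = 0" using a(2) by simp
      finally show ?thesis using us by simp
    qed
    then show False using ann a(1) by blast
  qed
  then show ?thesis using T by auto
qed

section \<open>Dimension and points of the dominant\<close>

lemma dim_E_eqI:
  assumes "T \<subseteq> S" "aff_indep_E E T" "card T = k"
    and "\<And>T. T \<subseteq> S \<Longrightarrow> aff_indep_E E T \<Longrightarrow> card T \<le> k"
  shows "dim_E E S = int k - 1"
proof -
  have "Max {card T | T. T \<subseteq> S \<and> aff_indep_E E T} = k"
  proof (rule Max_eqI)
    \<comment> \<open>\<open>Max\<close> is meaningful only on a finite set; the common bound
      \<open>k\<close> supplies finiteness even for infinite \<open>S\<close>.\<close>
    have "{card T | T. T \<subseteq> S \<and> aff_indep_E E T} \<subseteq> {..k}"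
      using assms(4) by blast
    then show "finite {card T | T. T \<subseteq> S \<and> aff_indep_E E T}"
      using finite_subset by blast
    show "y \<le> k" if "y \<in> {card T | T. T \<subseteq> S \<and> aff_indep_E E T}" for y
      using that assms(4) by blast
    show "k \<in> {card T | T. T \<subseteq> S \<and> aff_indep_E E T}"
      using assms(1-3) by blast
  qed
  then show ?thesis by (simp add: dim_E_def)
qed

lemma odd_cycle_subset: "C \<in> odd_cycles E \<Longrightarrow> C \<subseteq> E"
  by (auto simp: odd_cycles_def is_cycle_def)

lemma finite_odd_cycles: "finite E \<Longrightarrow> finite (odd_cycles E)"
  using odd_cycle_subset by (intro finite_subset[of "odd_cycles E" "Pow E"]) blast+

lemma sum_incidence:
  assumes "finite E" "C \<subseteq> E"
  shows "(\<Sum>e\<in>E. a e * incidence C e) = sum a C"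
proof -
  have "(\<Sum>e\<in>E. a e * incidence C e) = (\<Sum>e\<in>C. a e * incidence C e)"
    using assms by (intro sum.mono_neutral_right) (auto simp: incidence_def)
  also have "\<dots> = sum a C" by (intro sum.cong) (auto simp: incidence_def)
  finally show ?thesis .
qed

lemma incidence_plus_in_dominant:
  assumes "finite E" "C \<in> odd_cycles E" "\<forall>e\<in>E. r e \<ge> 0" "\<forall>e. e \<notin> E \<longrightarrow> r e = 0"
  shows "(\<lambda>e. incidence C e + r e) \<in> odd_cycle_dominant E"
proof -
  let ?A = "incidence ` odd_cycles E"
  have finA: "finite ?A" using assms finite_odd_cycles by auto
  have inA: "incidence C \<in> ?A" using assms by auto
  have "incidence C \<in> conv_fin ?A"
    unfolding conv_fin_def
  proof (intro CollectI exI[of _ "\<lambda>y. if y = incidence C then 1 else 0"] conjI ext)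
    show "(\<Sum>y\<in>?A. if y = incidence C then 1 else 0) = (1::real)"
      using finA inA by simp
    fix e
    have "(\<Sum>y\<in>?A. (if y = incidence C then 1 else 0) * y e)
        = (\<Sum>y\<in>?A. if y = incidence C then y e else 0)"
      by (intro sum.cong) auto
    also have "\<dots> = incidence C e" using finA inA by simp
    finally show "incidence C e = (\<Sum>y\<in>?A. (if y = incidence C then 1 else 0) * y e)" by simp
  qed auto
  then show ?thesis
    unfolding odd_cycle_dominant_def odd_cycle_polytope_def dominant_def
    by (intro CollectI bexI[of _ "incidence C"] exI[of _ r] conjI refl assms(3,4))
qed

text \<open>A lower bound on the generating cycles survives convex combination, and the nonnegative
  part \<open>r\<close> can only raise a nonnegative weight.\<close>

lemma odd_cycle_dominant_weight_ge:
  fixes w :: "nat set \<Rightarrow> real"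
  assumes "finite E" "\<And>e. e \<in> E \<Longrightarrow> w e \<ge> 0"
    and ge: "\<And>C. C \<in> odd_cycles E \<Longrightarrow> sum w C \<ge> \<beta>"
    and x: "x \<in> odd_cycle_dominant E"
  shows "(\<Sum>e\<in>E. w e * x e) \<ge> \<beta>"
proof -
  let ?A = "incidence ` odd_cycles E"
  obtain u r where u: "\<forall>y\<in>?A. u y \<ge> 0" "sum u ?A = 1" "\<forall>e\<in>E. r e \<ge> 0"
    "x = (\<lambda>e. (\<Sum>y\<in>?A. u y * y e) + r e)"
    using x unfolding odd_cycle_dominant_def odd_cycle_polytope_def dominant_def conv_fin_def
    by auto
  have "\<beta> = (\<Sum>y\<in>?A. u y * \<beta>)" using u(2) by (simp flip: sum_distrib_right)
  also have "\<dots> \<le> (\<Sum>y\<in>?A. u y * (\<Sum>e\<in>E. w e * y e))"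
  proof (intro sum_mono mult_left_mono)
    fix y assume "y \<in> ?A"
    then obtain C where C: "C \<in> odd_cycles E" "y = incidence C" by auto
    then show "\<beta> \<le> (\<Sum>e\<in>E. w e * y e)"
      using ge[OF C(1)] sum_incidence[OF assms(1) odd_cycle_subset[OF C(1)]] by simp
  qed (use u in auto)
  also have "\<dots> = (\<Sum>y\<in>?A. \<Sum>e\<in>E. w e * (u y * y e))"
    by (simp add: sum_distrib_left mult.left_commute)
  also have "\<dots> = (\<Sum>e\<in>E. w e * (\<Sum>y\<in>?A. u y * y e))"
    unfolding sum_distrib_left by (rule sum.swap)
  also have "\<dots> \<le> (\<Sum>e\<in>E. w e * x e)"
    using u(3,4) assms(2) by (intro sum_mono mult_left_mono) auto
  finally show ?thesis .
qed

section \<open>The facet cut out by a weight with enough tight cycles\<close>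

text \<open>A certificate for a facet: \<open>w\<close> gives a valid inequality with bound \<beta>,
  and \<open>tight_cycles_span\<close> says, in terms of annihilators, that the incidence vectors of
  the odd cycles attaining \<beta> span the whole space.\<close>

locale tight_weight =
  fixes E :: "nat set set" and w :: "nat set \<Rightarrow> real" and \<beta> :: real
  assumes finite_E: "finite E"
    and nonempty_E: "E \<noteq> {}"
    and weight_pos: "e \<in> E \<Longrightarrow> w e > 0"
    and \<beta>_pos: "\<beta> > 0"
    and odd_cycle_weight_ge: "C \<in> odd_cycles E \<Longrightarrow> sum w C \<ge> \<beta>"
    and tight_cycles_span: "\<lbrakk>\<And>C. C \<in> odd_cycles E \<Longrightarrow> sum w C = \<beta> \<Longrightarrow> sum (a :: nat set \<Rightarrow> real) C = 0; e \<in> E\<rbrakk> \<Longrightarrow> a e = 0"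
begin

definition facet :: "(nat set \<Rightarrow> real) set" where
  "facet = {x \<in> odd_cycle_dominant E. (\<Sum>e\<in>E. w e * x e) = \<beta>}"

lemma incidence_in_facet:
  assumes "C \<in> odd_cycles E" "sum w C = \<beta>"
  shows "incidence C \<in> facet"
  using incidence_plus_in_dominant[OF finite_E assms(1), of "\<lambda>_. 0"]
    sum_incidence[OF finite_E odd_cycle_subset[OF assms(1)]] assms
  by (simp add: facet_def)

text \<open>Subtracting \<open>b / \<beta>\<close> times the weight from \<open>a\<close> leaves a
  function that sums to zero on every tight cycle, hence is zero on \<open>E\<close>.\<close>

lemma facet_equation_proportional:
  assumes "\<And>x. x \<in> facet \<Longrightarrow> (\<Sum>e\<in>E. a e * x e) = b" "e \<in> E"
  shows "a e = b / \<beta> * w e"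
proof -
  have "sum (\<lambda>e. a e - b / \<beta> * w e) C = 0" if C: "C \<in> odd_cycles E" "sum w C = \<beta>" for C
  proof -
    have "sum a C = b"
      using assms(1)[OF incidence_in_facet[OF C]]
        sum_incidence[OF finite_E odd_cycle_subset[OF C(1)]] by simp
    moreover have "(\<Sum>e\<in>C. b / \<beta> * w e) = b"
      using C(2) \<beta>_pos unfolding sum_distrib_left[symmetric] by simp
    ultimately show ?thesis unfolding sum_subtractf by linarith
  qed
  from tight_cycles_span[OF this assms(2)] show ?thesis by simp
qed

lemma exists_lin_indep_in_facet: "\<exists>T\<subseteq>facet. lin_indep_E E T \<and> card T = card E"
proof (rule exists_lin_indep_E_card_eq[OF finite_E])
  fix a assume *: "\<And>s. s \<in> facet \<Longrightarrow> (\<Sum>e\<in>E. a e * s e) = 0"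
  show "\<forall>e\<in>E. a e = 0"
    using facet_equation_proportional[of a 0] * by auto
qed

lemma facet_subset: "facet \<subseteq> odd_cycle_dominant E"
  by (auto simp: facet_def)

lemma sum_weight_combination:
  fixes u :: "(nat set \<Rightarrow> real) \<Rightarrow> real"
  assumes "\<forall>e\<in>E. (\<Sum>t\<in>T. u t * t e) = 0"
  shows "(\<Sum>t\<in>T. u t * (\<Sum>e\<in>E. w e * t e)) = 0"
proof -
  have "(\<Sum>t\<in>T. u t * (\<Sum>e\<in>E. w e * t e)) = (\<Sum>t\<in>T. \<Sum>e\<in>E. w e * (u t * t e))"
    by (simp add: sum_distrib_left mult.left_commute)
  also have "\<dots> = (\<Sum>e\<in>E. w e * (\<Sum>t\<in>T. u t * t e))"
    unfolding sum_distrib_left by (rule sum.swap)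
  finally show ?thesis using assms by simp
qed

text \<open>Every point of \<open>facet\<close> has weight \<beta> > 0, so the hyperplane misses the
  origin and affinely independent subsets are linearly independent. This caps their size at
  \<open>card E\<close>.\<close>

lemma dim_facet: "dim_E E facet = int (card E) - 1"
proof -
  obtain T where T: "T \<subseteq> facet" "lin_indep_E E T" "card T = card E"
    using exists_lin_indep_in_facet by blast
  show ?thesis
  proof (rule dim_E_eqI[OF T(1) lin_indep_E_imp_aff_indep_E[OF T(2)] T(3)])
    fix T' assume T': "T' \<subseteq> facet" "aff_indep_E E T'"
    have "lin_indep_E E T'"
      unfolding lin_indep_E_def
    proof (intro conjI allI impI)
      show "finite T'" using T' by (simp add: aff_indep_E_def)
      fix u :: "(nat set \<Rightarrow> real) \<Rightarrow> real" assume u: "\<forall>e\<in>E. (\<Sum>t\<in>T'. u t * t e) = 0"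
      have "sum u T' * \<beta> = (\<Sum>t\<in>T'. u t * (\<Sum>e\<in>E. w e * t e))"
        unfolding sum_distrib_right using T'(1) by (intro sum.cong) (auto simp: facet_def)
      then have "sum u T' = 0" using sum_weight_combination[OF u] \<beta>_pos by simp
      then show "\<forall>t\<in>T'. u t = 0" using T'(2) u unfolding aff_indep_E_def by blast
    qed
    then show "card T' \<le> card E" using lin_indep_E_card_le[OF finite_E] by blast
  qed
qed

lemma exists_tight_cycle: "\<exists>C\<in>odd_cycles E. sum w C = \<beta>"
proof (rule ccontr)
  assume "\<not> ?thesis"
  \<comment> \<open>Without tight cycles the premise of \<open>tight_cycles_span\<close> is vacuous,
    even for the constant function 1.\<close>
  then have "(1::real) = 0" if "e \<in> E" for e
    using tight_cycles_span[of "\<lambda>_. 1", OF _ that] by blast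
  then show False using nonempty_E by auto
qed

lemma dim_dominant: "dim_E E (odd_cycle_dominant E) = int (card E)"
proof -
  obtain T where T: "T \<subseteq> facet" "lin_indep_E E T" "card T = card E"
    using exists_lin_indep_in_facet by blast
  have finT: "finite T" using T by (simp add: lin_indep_E_def)
  obtain C where C: "C \<in> odd_cycles E" "sum w C = \<beta>" using exists_tight_cycle by blast
  obtain e0 where e0: "e0 \<in> E" using nonempty_E by auto
  \<comment> \<open>Raising one coordinate of a tight cycle leaves the hyperplane of
    \<open>facet\<close>, so \<open>q\<close> extends \<open>T\<close> by an affinely independent
    point.\<close>
  define q where "q = (\<lambda>e. incidence C e + (if e = e0 then 1 else 0))"
  have q_in: "q \<in> odd_cycle_dominant E"
    unfolding q_def using e0 by (intro incidence_plus_in_dominant finite_E C) auto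
  have "(\<Sum>e\<in>E. w e * q e) = (\<Sum>e\<in>E. w e * incidence C e) + (\<Sum>e\<in>E. if e = e0 then w e else 0)"
    unfolding q_def sum.distrib[symmetric] by (intro sum.cong) (auto simp: distrib_left)
  then have wq: "(\<Sum>e\<in>E. w e * q e) = \<beta> + w e0"
    using sum_incidence[OF finite_E odd_cycle_subset[OF C(1)]] C e0 finite_E by simp
  have q_notin: "q \<notin> T"
    using T(1) wq weight_pos[OF e0] by (auto simp: facet_def)
  have ind: "aff_indep_E E (insert q T)"
    unfolding aff_indep_E_def
  proof (intro conjI allI impI)
    fix u assume u: "sum u (insert q T) = 0 \<and> (\<forall>e\<in>E. (\<Sum>t\<in>insert q T. u t * t e) = 0)"
    have "(\<Sum>t\<in>T. u t * (\<Sum>e\<in>E. w e * t e)) = sum u T * \<beta>"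
      unfolding sum_distrib_right using T(1) by (intro sum.cong) (auto simp: facet_def)
    moreover have "(\<Sum>t\<in>insert q T. u t * (\<Sum>e\<in>E. w e * t e)) = 0"
      using sum_weight_combination u by blast
    ultimately have "u q * (\<beta> + w e0) + sum u T * \<beta> = 0"
      using finT q_notin wq by simp
    moreover have "sum u T = - u q" using u finT q_notin by (simp add: eq_neg_iff_add_eq_0 add.commute)
    \<comment> \<open>The coefficients sum to zero, so the contributions of \<beta> cancel and only
      the excess weight of \<open>q\<close> remains.\<close>
    ultimately have "u q * w e0 = 0" by (simp add: algebra_simps)
    then have uq: "u q = 0" using weight_pos[OF e0] by simp
    then have "\<forall>e\<in>E. (\<Sum>t\<in>T. u t * t e) = 0" using u finT q_notin by simp
    then have "\<forall>t\<in>T. u t = 0" using T(2) unfolding lin_indep_E_def by blast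
    then show "\<forall>t\<in>insert q T. u t = 0" using uq by simp
  qed (use finT in simp)
  have "dim_E E (odd_cycle_dominant E) = int (card E + 1) - 1"
  proof (rule dim_E_eqI[OF _ ind])
    show "card (insert q T) = card E + 1" using finT q_notin T by simp
  qed (use q_in T facet_subset aff_indep_E_card_le[OF finite_E] in auto)
  then show ?thesis by simp
qed

lemma facet_E_facet: "facet_E E (odd_cycle_dominant E) facet"
  unfolding facet_E_def
proof (intro conjI)
  show "face_E E (odd_cycle_dominant E) facet"
    unfolding face_E_def
  \<comment> \<open>\<open>face_E\<close> asks for an upper bound, hence the negated weight.\<close>
  proof (intro exI[of _ "\<lambda>e. - w e"] exI[of _ "- \<beta>"] conjI ballI)
    fix x assume "x \<in> odd_cycle_dominant E"
    then have "(\<Sum>e\<in>E. w e * x e) \<ge> \<beta>"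
      using weight_pos less_imp_le
      by (intro odd_cycle_dominant_weight_ge[OF finite_E _ odd_cycle_weight_ge]) auto
    then show "(\<Sum>e\<in>E. - w e * x e) \<le> - \<beta>" by (simp add: sum_negf)
  qed (auto simp: facet_def sum_negf)
  show "facet \<noteq> {}" using exists_tight_cycle incidence_in_facet by auto
qed (simp add: dim_facet dim_dominant)

lemma facet_ne_dominant: "facet \<noteq> odd_cycle_dominant E"
  using dim_facet dim_dominant by auto

text \<open>The factor is \<open>b / \<beta>\<close>. Were it zero, the equation would hold on the
  whole dominant, which has larger dimension than \<open>facet\<close>.\<close>

lemma facet_equation_multiple:
  assumes "facet = {x\<in>odd_cycle_dominant E. (\<Sum>e\<in>E. a e * x e) = b}"
  shows "\<exists>\<mu>. \<mu> \<noteq> 0 \<and> (\<forall>e\<in>E. a e = \<mu> * w e)"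
proof (intro exI[of _ "b / \<beta>"] conjI ballI)
  have eq: "a e = b / \<beta> * w e" if "e \<in> E" for e
    using facet_equation_proportional[OF _ that, of a b] assms by blast
  then show "a e = b / \<beta> * w e" if "e \<in> E" for e using that .
  show "b / \<beta> \<noteq> 0"
  proof
    assume 0: "b / \<beta> = 0"
    then have "b = 0" using \<beta>_pos by simp
    moreover have "(\<Sum>e\<in>E. a e * x e) = 0" for x
      using eq 0 by (intro sum.neutral) simp
    ultimately have "facet = odd_cycle_dominant E" using assms by simp
    then show False using facet_ne_dominant by simp
  qed
qed

end

section \<open>Odd cycles in complete graphs\<close>

definition complete_edges :: "nat \<Rightarrow> nat set set" where
  "complete_edges n = {{u, v} | u v. u \<noteq> v \<and> u < n \<and> v < n}"

lemma finite_complete_edges: "finite (complete_edges n)"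
  by (rule finite_subset[of _ "Pow {..<n}"]) (auto simp: complete_edges_def)

lemma complete_edges_iff: "{u, v} \<in> complete_edges n \<longleftrightarrow> u \<noteq> v \<and> u < n \<and> v < n"
  by (auto simp: complete_edges_def doubleton_eq_iff)

definition cycle_edge :: "nat list \<Rightarrow> nat \<Rightarrow> nat set" where
  "cycle_edge vs i = {vs ! i, vs ! ((i + 1) mod length vs)}"

lemma succ_mod: "k < L \<Longrightarrow> (k + 1) mod L = (if k + 1 = L then 0 else k + 1)" for k L :: nat
  by (cases "k + 1 = L") auto

text \<open>If two positions gave the same edge, each would be the cyclic successor of the other,
  which needs length at most 2. Hence cardinality and sums over a cycle can be computed along its
  list.\<close>

lemma inj_on_cycle_edge:
  assumes "length vs \<ge> 3" "distinct vs"
  shows "inj_on (cycle_edge vs) {..<length vs}"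
proof (rule inj_onI, rule ccontr)
  let ?L = "length vs"
  fix i j assume ij: "i \<in> {..<?L}" "j \<in> {..<?L}" "cycle_edge vs i = cycle_edge vs j" "i \<noteq> j"
  have eq_iff: "vs ! k = vs ! l \<longleftrightarrow> k = l" if "k < ?L" "l < ?L" for k l
    using assms that by (simp add: nth_eq_iff_index_eq)
  have "(k + 1) mod ?L < ?L" for k using assms by (intro mod_less_divisor) linarith
  then have "i = (j + 1) mod ?L" "j = (i + 1) mod ?L"
    using ij by (auto simp: cycle_edge_def doubleton_eq_iff eq_iff)
  then show False
    using ij(1,2) assms(1) by (simp only: succ_mod lessThan_iff split: if_splits)
qed

lemma odd_cyclesE:
  assumes "C \<in> odd_cycles E"
  obtains vs where "length vs \<ge> 3" "distinct vs" "odd (length vs)"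
    "\<And>i. i < length vs \<Longrightarrow> cycle_edge vs i \<in> E"
    "\<And>f :: nat set \<Rightarrow> real. sum f C = (\<Sum>i<length vs. f (cycle_edge vs i))"
proof -
  obtain vs where vs: "length vs \<ge> 3" "distinct vs" and C: "C = cycle_edge vs ` {..<length vs}"
    using assms by (auto simp: odd_cycles_def is_cycle_def cycle_edge_def)
  note inj = inj_on_cycle_edge[OF vs]
  have "odd (length vs)"
    using assms card_image[OF inj] by (simp add: C odd_cycles_def)
  moreover have "cycle_edge vs i \<in> E" if "i < length vs" for i
    using odd_cycle_subset[OF assms] that by (auto simp: C)
  moreover have "sum f C = (\<Sum>i<length vs. f (cycle_edge vs i))" for f :: "nat set \<Rightarrow> real"
    by (simp add: C sum.reindex[OF inj])
  ultimately show thesis using that vs by blast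
qed

lemma odd_cycle_in_complete:
  assumes "length vs \<ge> 3" "distinct vs" "odd (length vs)" "set vs \<subseteq> {..<n}"
  defines "C \<equiv> cycle_edge vs ` {..<length vs}"
  shows "C \<in> odd_cycles (complete_edges n)"
    and "sum f C = (\<Sum>i<length vs. f (cycle_edge vs i))"
proof -
  note inj = inj_on_cycle_edge[OF assms(1,2)]
  have "cycle_edge vs i \<in> complete_edges n" if i: "i < length vs" for i
  proof -
    have *: "(i + 1) mod length vs < length vs" "(i + 1) mod length vs \<noteq> i"
      using assms(1) i unfolding succ_mod[OF i] by auto
    then have "vs ! i \<noteq> vs ! ((i + 1) mod length vs)"
      using assms(2) i by (simp add: nth_eq_iff_index_eq)
    moreover have "vs ! i < n" "vs ! ((i + 1) mod length vs) < n"
      using assms(4) i * nth_mem by blast+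
    ultimately show ?thesis by (simp add: cycle_edge_def complete_edges_iff)
  qed
  then have "is_cycle (complete_edges n) C"
    unfolding is_cycle_def C_def using assms(1,2)
    by (intro conjI exI[of _ vs]) (auto simp: cycle_edge_def)
  then show "C \<in> odd_cycles (complete_edges n)"
    using card_image[OF inj] assms(3) by (simp add: odd_cycles_def C_def)
  show "sum f C = (\<Sum>i<length vs. f (cycle_edge vs i))"
    unfolding C_def by (simp add: sum.reindex[OF inj])
qed

text \<open>The Boolean argument of the potential \<open>h\<close> is the parity class in the bipartite double
  cover; an odd closed walk through \<open>v s\<close> lifts to a walk between the two copies of \<open>v s\<close>.\<close>

lemma odd_closed_walk_weight_ge:
  fixes f :: "nat \<Rightarrow> real" and h :: "nat \<Rightarrow> bool \<Rightarrow> real"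
  assumes L: "odd L" "s < L"
    and step: "\<And>i b. i < L \<Longrightarrow> h (v ((i + 1) mod L)) (\<not> b) \<le> h (v i) b + f i"
  shows "h (v s) False \<le> h (v s) True + (\<Sum>i<L. f i)"
proof -
  \<comment> \<open>At \<open>k = L\<close> the walk is back at \<open>v s\<close>, and
    \<open>even L\<close> is false, so it ends in the other copy.\<close>
  have walk: "h (v ((s + k) mod L)) (even k) \<le> h (v s) True + (\<Sum>j<k. f ((s + j) mod L))" for k
  proof (induction k)
    case 0
    then show ?case using L by simp
  next
    case (Suc k)
    have "(s + k) mod L < L" using L by simp
    from step[OF this, of "even k"] Suc show ?case by (simp add: mod_simps)
  qed
  \<comment> \<open>Starting at \<open>s\<close> only rotates the summation indices.\<close>
  have "(\<Sum>j<L. f ((s + j) mod L)) = (\<Sum>i<L. f i)"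
  proof (rule sum.reindex_bij_witness[of _ "\<lambda>i. (i + (L - s)) mod L" "\<lambda>j. (s + j) mod L"])
    fix j assume "j \<in> {..<L}"
    then show "((s + j) mod L + (L - s)) mod L = j"
      using L unfolding mod_add_left_eq by simp
  next
    fix i assume "i \<in> {..<L}"
    then show "(s + (i + (L - s)) mod L) mod L = i"
      using L unfolding mod_add_right_eq by simp
  qed (use L in auto)
  then show ?thesis using walk[of L] L by simp
qed

section \<open>The weights\<close>

text \<open>On \<open>{..<m}\<close>, viewed as a cycle of odd length \<open>m\<close>, a pair gets the length of the odd one of
  the two arcs joining it; the vertices \<open>m\<close> and \<open>m + 1\<close> are the two extra ones.\<close>

definition pair_weight :: "nat \<Rightarrow> nat \<Rightarrow> nat \<Rightarrow> nat" where
  "pair_weight m i j =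
     (if i < m \<and> j < m then
        (if odd (i + j) then (i - j) + (j - i) else m - ((i - j) + (j - i)))
      else if i < m \<or> j < m then (m - 1) div 2 else 1)"

lemma pair_weight_commute: "pair_weight m i j = pair_weight m j i"
  by (auto simp: pair_weight_def add.commute)

lemma pair_weight_pos:
  assumes "odd m" "m \<ge> 3" "i \<noteq> j"
  shows "pair_weight m i j > 0"
  using assms by (auto simp: pair_weight_def)

text \<open>For \<open>r\<close> and \<open>v\<close> below \<open>m\<close> this is the residue of
  \<open>v - r\<close> modulo \<open>m\<close>: the rotation moving the root \<open>r\<close> to
  0.\<close>

definition cyc_offset :: "nat \<Rightarrow> nat \<Rightarrow> nat \<Rightarrow> nat" where
  "cyc_offset m r v = (if r \<le> v then v - r else v + m - r)"

text \<open>The distance from the even copy of \<open>r\<close> in the double cover.\<close>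

definition potential :: "nat \<Rightarrow> nat \<Rightarrow> nat \<Rightarrow> bool \<Rightarrow> nat" where
  "potential m r v ev =
     (if v < m then
        (if even (cyc_offset m r v) = ev then cyc_offset m r v else m - cyc_offset m r v)
      else if ev then (m + 1) div 2 else (m - 1) div 2)"

lemma cyc_offset_less: "r < m \<Longrightarrow> v < m \<Longrightarrow> cyc_offset m r v < m"
  by (auto simp: cyc_offset_def)

text \<open>Rotation invariance. If just one of the two points wraps around, the distance
  \<open>d\<close> becomes \<open>m - d\<close>, and the parity of the sum flips because
  \<open>m\<close> is odd; the two changes cancel in \<open>pair_weight\<close>.\<close>

lemma pair_weight_cyc_offset:
  assumes "odd m" "r < m" "u < m" "v < m"
  shows "pair_weight m (cyc_offset m r u) (cyc_offset m r v) = pair_weight m u v"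
proof -
  let ?s = "cyc_offset m r u" and ?t = "cyc_offset m r v"
  have shift: "r \<le> x \<and> x = r + cyc_offset m r x \<or> x < r \<and> x + m = r + cyc_offset m r x"
    if "x < m" for x
    using assms(2) that by (auto simp: cyc_offset_def)
  have lt: "?s < m" "?t < m" using assms cyc_offset_less by auto
  from shift[OF assms(3)] shift[OF assms(4)] show ?thesis
  proof (elim disjE conjE)
    assume *: "u = r + ?s" "v = r + ?t"
    then have "even (u + v) = even (?s + ?t)" by presburger
    moreover have "(u - v) + (v - u) = (?s - ?t) + (?t - ?s)" using * by linarith
    ultimately show ?thesis using assms lt by (simp add: pair_weight_def)
  next
    assume *: "u + m = r + ?s" "v + m = r + ?t"
    then have "even (u + v) = even (?s + ?t)" by presburger
    moreover have "(u - v) + (v - u) = (?s - ?t) + (?t - ?s)" using * by linarith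
    ultimately show ?thesis using assms lt by (simp add: pair_weight_def)
  next
    assume *: "r \<le> u" "u = r + ?s" "v < r" "v + m = r + ?t"
    then have "even (u + v) = odd (?s + ?t)" using assms(1) by presburger
    moreover have "(u - v) + (v - u) = m - ((?s - ?t) + (?t - ?s))" "(?s - ?t) + (?t - ?s) \<le> m"
      using * assms by linarith+
    ultimately show ?thesis using assms lt by (simp add: pair_weight_def)
  next
    assume *: "u < r" "u + m = r + ?s" "r \<le> v" "v = r + ?t"
    then have "even (u + v) = odd (?s + ?t)" using assms(1) by presburger
    moreover have "(u - v) + (v - u) = m - ((?s - ?t) + (?t - ?s))" "(?s - ?t) + (?t - ?s) \<le> m"
      using * assms by linarith+
    ultimately show ?thesis using assms lt by (simp add: pair_weight_def)
  qed
qed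

text \<open>The triangle inequality for distances in the double cover. Between two cycle vertices it
  is checked after rotating \<open>r\<close> to 0; for edges between the cycle and an extra vertex
  the estimate is short by one, which parity makes up.\<close>

lemma potential_step:
  assumes "odd m" "r < m" "u \<noteq> v" "u < m + 2" "v < m + 2"
  shows "potential m r v (\<not> b) \<le> potential m r u b + pair_weight m u v"
proof -
  obtain k where k: "m = 2 * k + 1" using assms by (auto elim: oddE)
  let ?s = "cyc_offset m r u" and ?t = "cyc_offset m r v"
  \<comment> \<open>Both arcs are covered by one parity rule, so odd values are positive and even
    values are at most \<open>m - 1\<close>. This is the missing unit in cases 2 and 3.\<close>
  have potential_less: "potential m r x b \<in> {..m} \<and> (even (potential m r x b) \<longleftrightarrow> b)"
    if "x < m" for x b
    using cyc_offset_less[OF assms(2) that] that assms(1)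
    by (cases b; cases "even (cyc_offset m r x)") (auto simp: potential_def)
  consider "u < m" "v < m" | "u < m" "v \<ge> m" | "u \<ge> m" "v < m" | "u \<ge> m" "v \<ge> m" by linarith
  then show ?thesis
  proof cases
    case 1
    then have lt: "?s < m" "?t < m" using cyc_offset_less assms(2) by auto
    then have "pair_weight m u v =
        (if odd (?s + ?t) then (?s - ?t) + (?t - ?s) else m - ((?s - ?t) + (?t - ?s)))"
      using pair_weight_cyc_offset[OF assms(1,2) 1] by (simp add: pair_weight_def)
    then show ?thesis
      using 1 lt unfolding potential_def
      by (cases b; cases "even ?s"; cases "even ?t"; simp; linarith)
  next
    case 2
    then have "potential m r v (\<not> b) = (if b then k else k + 1)" "pair_weight m u v = k"
      using k by (auto simp: potential_def pair_weight_def)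
    moreover have "potential m r u b > 0" if "\<not> b"
      using potential_less[OF 2(1), of b] that by (cases "potential m r u b = 0") auto
    ultimately show ?thesis by (cases b) auto
  next
    case 3
    then have "even (potential m r v (\<not> b)) \<longleftrightarrow> \<not> b" "potential m r v (\<not> b) \<le> m"
      using potential_less by auto
    moreover from this have "b \<or> potential m r v (\<not> b) \<le> 2 * k"
      using k by (cases "potential m r v (\<not> b) = m") auto
    moreover have "potential m r u b = (if b then k + 1 else k)" "pair_weight m u v = k"
      using 3 k by (auto simp: potential_def pair_weight_def)
    ultimately show ?thesis using k by (cases b) auto
  next
    case 4
    then show ?thesis using assms k
      unfolding potential_def pair_weight_def by (cases b) auto
  qed
qed

lemma potential_root: "odd m \<Longrightarrow> r < m \<Longrightarrow> potential m r r True = 0 \<and> potential m r r False = m"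
  by (simp add: potential_def cyc_offset_def)

section \<open>Rigidity: tight triangles and pentagons determine the weights\<close>

text \<open>All values are expressed through \<alpha>, the value on the pair of extra vertices:
  pairs joining the cycle to an extra vertex get half of \<alpha> with opposite sign, and a pair
  \<open>i\<close>, \<open>j\<close> with odd difference \<open>t\<close> gets
  \<open>t * \<alpha>\<close>. The triangle on 0, 1, \<open>m - 1\<close> then yields
  \<open>m * \<alpha> = 0\<close>.\<close>

lemma tight_function_zero:
  fixes b :: "nat \<Rightarrow> nat \<Rightarrow> real"
  assumes m: "odd m" "m \<ge> 5"
    and sym: "\<And>i j. b i j = b j i"
    and tri: "\<And>i j k. \<lbrakk>distinct [i, j, k]; {i, j, k} \<subseteq> {..<m + 2};
        pair_weight m i j + pair_weight m j k + pair_weight m k i = m\<rbrakk>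
      \<Longrightarrow> b i j + b j k + b k i = 0"
    and pent: "\<And>i j k l r. \<lbrakk>distinct [i, j, k, l, r]; {i, j, k, l, r} \<subseteq> {..<m + 2};
        pair_weight m i j + pair_weight m j k + pair_weight m k l + pair_weight m l r
          + pair_weight m r i = m\<rbrakk>
      \<Longrightarrow> b i j + b j k + b k l + b l r + b r i = 0"
    and ij: "i \<noteq> j" "i < m + 2" "j < m + 2"
  shows "b i j = 0"
proof -
  obtain q where q: "m = 2 * q + 1" using m by (auto elim: oddE)
  have step: "b i (i + 1) + b (i + 1) z + b z i = 0" if "i + 1 < m" "z = m \<or> z = m + 1" for i z
    using that q by (intro tri) (auto simp: pair_weight_def)
  have wrap: "b 0 (m - 1) + b (m - 1) z + b z 0 = 0" if "z = m \<or> z = m + 1" for z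
    using that q m by (intro tri) (auto simp: pair_weight_def)
  have apex: "b m (m + 1) + b (m + 1) i + b i m = 0" if "i < m" for i
    using that q by (intro tri) (auto simp: pair_weight_def)
  \<comment> \<open>The difference \<open>d\<close> alternates in sign along a cycle of odd length, so it vanishes.\<close>
  define d where "d i = b i m - b i (m + 1)" for i
  have d_alt: "d i = (- 1) ^ i * d 0" if "i < m" for i
    using that
  proof (induction i)
    case (Suc i)
    then have "d (Suc i) = - d i"
      using step[of i m] step[of i "m + 1"] sym[of i m] sym[of i "m + 1"] by (simp add: d_def)
    then show ?case using Suc by simp
  qed simp
  have "d (m - 1) = - d 0"
    using wrap[of m] wrap[of "m + 1"] sym[of 0 m] sym[of 0 "m + 1"] by (simp add: d_def)
  then have "d 0 = 0" using d_alt[of "m - 1"] m by simp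
  then have "d i = 0" if "i < m" for i using d_alt[OF that] by simp
  then have eq: "b i m = b i (m + 1)" if "i < m" for i using that by (simp add: d_def)
  define \<alpha> where "\<alpha> = b m (m + 1)"
  have apex_m: "b i m = - \<alpha> / 2" if "i < m" for i
    using apex[OF that] eq[OF that] sym[of i "m + 1"] by (simp add: \<alpha>_def)
  have unit: "b i (i + 1) = \<alpha>" if "i + 1 < m" for i
    using step[of i m] apex_m[of i] apex_m[of "i + 1"] sym[of i m] that by simp
  have last: "b 0 (m - 1) = \<alpha>"
    using wrap[of m] apex_m[of 0] apex_m[of "m - 1"] sym[of 0 m] m by simp
  \<comment> \<open>The odd gaps add up to \<open>k - i\<close>, and the closing pair, of even
    difference, has weight \<open>m - (k - i)\<close>; the total is \<open>m\<close>. The pentagons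
    below work alike.\<close>
  have tri_odd: "b i j + b j k + b k i = 0"
    if "i < j" "j < k" "k < m" "odd (i + j)" "odd (j + k)" for i j k
    using that by (intro tri) (auto simp: pair_weight_def)
  have pent_odd: "b i j + b j k + b k l + b l r + b r i = 0"
    if "i < j" "j < k" "k < l" "l < r" "r < m" "odd (i + j)" "odd (j + k)" "odd (k + l)" "odd (l + r)"
    for i j k l r
  proof (rule pent)
    have "even (i + r)" using that by presburger
    then show "pair_weight m i j + pair_weight m j k + pair_weight m k l + pair_weight m l r
          + pair_weight m r i = m"
      using that by (simp add: pair_weight_def add.commute)
  qed (use that in auto)
  have odd_arc: "b i (i + (2 * t + 1)) = of_nat (2 * t + 1) * \<alpha>" if "i + (2 * t + 1) < m" for i t
    using that
  proof (induction t arbitrary: i)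
    case 0
    then show ?case using unit[of i] by simp
  next
    case (Suc t)
    define l where "l = i + (2 * Suc t + 1)"
    have l: "l = (i + 2) + (2 * t + 1)" "l < m" using Suc.prems by (auto simp: l_def)
    \<comment> \<open>Replacing the chord from \<open>i\<close> to \<open>l\<close> in a tight
      triangle by the path through \<open>i + 1\<close> and \<open>i + 2\<close> gives a tight
      pentagon; subtracting the two equations leaves this. The third vertex of the triangle is
      \<open>l + 1\<close>, or \<open>i - 1\<close> if \<open>l\<close> is the last cycle
      vertex.\<close>
    have "b i l = b i (i + 1) + b (i + 1) (i + 2) + b (i + 2) l"
    proof (cases "l + 1 < m")
      case True
      then have "b i (i + 1) + b (i + 1) (i + 2) + b (i + 2) l + b l (l + 1) + b (l + 1) i = 0"
        using l by (intro pent_odd) auto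
      moreover have "b i l + b l (l + 1) + b (l + 1) i = 0"
        using l True by (intro tri_odd) auto
      ultimately show ?thesis by simp
    next
      case False
      then have "m = l + 1" using l by simp
      \<comment> \<open>Here \<open>l = m - 1\<close> is even and \<open>l - i\<close> is odd, so
        \<open>i\<close> is odd.\<close>
      then have "i > 0" using m l by (cases i) auto
      then have i: "i - 1 + 1 = i" by simp
      have "b (i - 1) i + b i (i + 1) + b (i + 1) (i + 2) + b (i + 2) l + b l (i - 1) = 0"
        using l \<open>i > 0\<close> by (intro pent_odd) auto
      moreover have "b (i - 1) i + b i l + b l (i - 1) = 0"
        using l \<open>i > 0\<close> by (intro tri_odd) auto
      ultimately show ?thesis by simp
    qed
    also have "\<dots> = \<alpha> + \<alpha> + of_nat (2 * t + 1) * \<alpha>"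
      using unit[of i] unit[of "i + 1"] Suc.IH[of "i + 2"] l by (simp add: add.assoc)
    finally show ?case by (simp add: l_def algebra_simps)
  qed
  have "of_nat m * \<alpha> = 0"
  proof -
    have "b 0 1 + b 1 (m - 1) + b (m - 1) 0 = 0"
      using m by (intro tri_odd) auto
    moreover have "b 1 (m - 1) = of_nat (2 * (q - 1) + 1) * \<alpha>"
    proof -
      have "m - 1 = 1 + (2 * (q - 1) + 1)" "1 + (2 * (q - 1) + 1) < m" using q m by auto
      then show ?thesis using odd_arc[of 1 "q - 1"] by simp
    qed
    ultimately show ?thesis
      using unit[of 0] last sym[of 0 "m - 1"] q m by (simp add: algebra_simps of_nat_diff)
  qed
  then have \<alpha>0: "\<alpha> = 0" using m by simp
  have zero: "b i j = 0" if "i < j" "j < m + 2" for i j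
  proof -
    consider "j < m" "odd (i + j)" | "j < m" "even (i + j)" | "j \<ge> m" "i < m" | "i = m" "j = m + 1"
    proof (cases "j < m")
      case True
      then show thesis using that(1,2) by blast
    next
      case False
      then show thesis using that(3,4) \<open>i < j\<close> \<open>j < m + 2\<close> by (cases "i < m") auto
    qed
    then show ?thesis
    proof cases
      case 1
      then have "\<exists>t. j = i + (2 * t + 1)"
        using \<open>i < j\<close> by presburger
      then obtain t where "j = i + (2 * t + 1)" by blast
      then show ?thesis using odd_arc[of i t] 1 \<alpha>0 by simp
    next
      case 2
      then have "\<exists>t. j = (i + 1) + (2 * t + 1)"
        using \<open>i < j\<close> by presburger
      then obtain t where t: "j = (i + 1) + (2 * t + 1)" by blast
      \<comment> \<open>Inserting \<open>i + 1\<close> splits an even difference into two odd ones,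
        where the values are already known.\<close>
      have "b i (i + 1) + b (i + 1) j + b j i = 0"
        using 2 t by (intro tri_odd) auto
      then show ?thesis
        using odd_arc[of "i + 1" t] unit[of i] t 2 \<alpha>0 sym[of i j] by simp
    next
      case 3
      then have "j = m \<or> j = m + 1" using that by linarith
      moreover have "b i m = 0" using apex_m[OF 3(2)] \<alpha>0 by simp
      moreover from this have "b i (m + 1) = 0" using eq[OF 3(2)] by linarith
      ultimately show ?thesis by blast
    next
      case 4
      then show ?thesis using \<alpha>0 by (simp add: \<alpha>_def)
    qed
  qed
  show ?thesis
  proof (cases "i < j")
    case True
    then show ?thesis using zero ij by blast
  next
    case False
    then have "b j i = 0" using zero ij by simp
    then show ?thesis by (simp add: sym[of i j])
  qed
qed

text \<open>\<open>Min\<close> and \<open>Max\<close> select the endpoints of an unordered edge;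
  their order is immaterial because \<open>pair_weight\<close> is symmetric.\<close>

definition edge_weight :: "nat \<Rightarrow> (nat \<Rightarrow> nat) \<Rightarrow> nat set \<Rightarrow> real" where
  "edge_weight m \<sigma> e = real (pair_weight m (\<sigma> (Min e)) (\<sigma> (Max e)))"

lemma edge_weight_pair: "edge_weight m \<sigma> {u, v} = real (pair_weight m (\<sigma> u) (\<sigma> v))"
  by (cases "u \<le> v") (auto simp: edge_weight_def max_def min_def pair_weight_commute)

lemma tight_weight_edge_weight:
  assumes m: "odd m" "m \<ge> 5"
    and \<sigma>: "\<And>u. u < m + 2 \<Longrightarrow> \<sigma> u < m + 2" "\<And>u. u < m + 2 \<Longrightarrow> \<sigma> (\<sigma> u) = u"
  shows "tight_weight (complete_edges (m + 2)) (edge_weight m \<sigma>) (real m)"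
proof
  show "finite (complete_edges (m + 2))" by (rule finite_complete_edges)
  have "{0, 1} \<in> complete_edges (m + 2)" by (simp add: complete_edges_iff)
  then show "complete_edges (m + 2) \<noteq> {}" by blast
  show "real m > 0" using m by simp
  have \<sigma>_eq_iff: "\<sigma> u = \<sigma> v \<longleftrightarrow> u = v" if "u < m + 2" "v < m + 2" for u v
    using \<sigma>(2) that by metis
  show "edge_weight m \<sigma> e > 0" if "e \<in> complete_edges (m + 2)" for e
    using that m pair_weight_pos[of m] \<sigma>_eq_iff by (auto simp: complete_edges_def edge_weight_pair)
  show "sum (edge_weight m \<sigma>) C \<ge> real m" if C: "C \<in> odd_cycles (complete_edges (m + 2))" for C
  proof -
    obtain vs where vs: "length vs \<ge> 3" "distinct vs" "odd (length vs)"
      "\<And>i. i < length vs \<Longrightarrow> cycle_edge vs i \<in> complete_edges (m + 2)"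
      "\<And>f :: nat set \<Rightarrow> real. sum f C = (\<Sum>i<length vs. f (cycle_edge vs i))"
      using odd_cyclesE[OF C] by blast
    have lt: "vs ! i < m + 2" if "i < length vs" for i
      using vs(4)[OF that] by (simp add: cycle_edge_def complete_edges_iff)
    \<comment> \<open>The potential must be rooted at a vertex whose label lies on the cycle; three
      distinct vertices cannot all carry the two extra labels.\<close>
    have "\<exists>s<length vs. \<sigma> (vs ! s) < m"
    proof (rule ccontr)
      assume none: "\<not> ?thesis"
      have "\<sigma> (vs ! i) \<in> {m, m + 1}" if "i < length vs" for i
        using none \<sigma>(1)[OF lt[OF that]] that by auto
      moreover have "inj_on (\<lambda>i. \<sigma> (vs ! i)) {..<length vs}"
        using vs(2) lt \<sigma>_eq_iff by (auto simp: inj_on_def nth_eq_iff_index_eq)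
      ultimately have "card {..<length vs} \<le> card {m, m + 1}"
        by (intro card_inj_on_le) auto
      then show False using vs(1) by simp
    qed
    then obtain s where s: "s < length vs" "\<sigma> (vs ! s) < m" by auto
    let ?r = "\<sigma> (vs ! s)"
    have "real (potential m ?r ?r False) \<le> real (potential m ?r ?r True)
        + (\<Sum>i<length vs. edge_weight m \<sigma> (cycle_edge vs i))"
    proof (rule odd_closed_walk_weight_ge[OF vs(3) s(1),
          where v = "\<lambda>i. \<sigma> (vs ! i)" and h = "\<lambda>v b. real (potential m ?r v b)"])
      fix i b assume i: "i < length vs"
      let ?j = "(i + 1) mod length vs"
      have "vs ! i \<noteq> vs ! ?j" "vs ! i < m + 2" "vs ! ?j < m + 2"
        using vs(4)[OF i] by (auto simp: cycle_edge_def complete_edges_iff)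
      then have "potential m ?r (\<sigma> (vs ! ?j)) (\<not> b)
          \<le> potential m ?r (\<sigma> (vs ! i)) b + pair_weight m (\<sigma> (vs ! i)) (\<sigma> (vs ! ?j))"
        using m(1) s(2) \<sigma>(1) \<sigma>_eq_iff by (intro potential_step) auto
      then show "real (potential m ?r (\<sigma> (vs ! ?j)) (\<not> b))
          \<le> real (potential m ?r (\<sigma> (vs ! i)) b) + edge_weight m \<sigma> (cycle_edge vs i)"
        by (simp add: cycle_edge_def edge_weight_pair)
    qed
    \<comment> \<open>The potentials of the two copies of the root are 0 and \<open>m\<close>, so
      the closed walk has weight at least \<open>m\<close>.\<close>
    then show ?thesis using potential_root[OF m(1) s(2)] by (simp add: vs(5))
  qed
  fix a :: "nat set \<Rightarrow> real" and e
  assume tight: "\<And>C. C \<in> odd_cycles (complete_edges (m + 2)) \<Longrightarrow>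
      sum (edge_weight m \<sigma>) C = real m \<Longrightarrow> sum a C = 0"
    and e: "e \<in> complete_edges (m + 2)"
  \<comment> \<open>Pulling \<open>a\<close> back along the involution \<sigma> turns tight cycles
    for \<open>edge_weight\<close> into tight lists for the unlabelled
    \<open>pair_weight\<close>.\<close>
  define b where "b i j = a {\<sigma> i, \<sigma> j}" for i j
  have relabelled: "(\<Sum>i<length is. b (is ! i) (is ! ((i + 1) mod length is))) = 0"
    if "is": "length is \<ge> 3" "odd (length is)" "distinct is" "set is \<subseteq> {..<m + 2}"
      "(\<Sum>i<length is. pair_weight m (is ! i) (is ! ((i + 1) mod length is))) = m" for "is"
  proof -
    let ?vs = "map \<sigma> is"
    have "length ?vs \<ge> 3" "odd (length ?vs)" using "is" by auto
    moreover have "distinct ?vs"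
      using "is"(3,4) \<sigma>_eq_iff by (auto simp: distinct_map inj_on_def)
    moreover have "set ?vs \<subseteq> {..<m + 2}" using "is"(4) \<sigma>(1) by auto
    ultimately have cyc: "cycle_edge ?vs ` {..<length ?vs} \<in> odd_cycles (complete_edges (m + 2))"
        "\<And>f :: nat set \<Rightarrow> real. sum f (cycle_edge ?vs ` {..<length ?vs})
          = (\<Sum>i<length ?vs. f (cycle_edge ?vs i))"
      using odd_cycle_in_complete[of ?vs "m + 2"] by blast+
    have edge: "cycle_edge ?vs i = {\<sigma> (is ! i), \<sigma> (is ! ((i + 1) mod length is))}"
      if "i < length is" for i
    proof -
      have "(i + 1) mod length is < length is" using "is"(1) by (intro mod_less_divisor) linarith
      then show ?thesis using that by (simp add: cycle_edge_def)
    qed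
    have "edge_weight m \<sigma> (cycle_edge ?vs i)
        = real (pair_weight m (is ! i) (is ! ((i + 1) mod length is)))" if i: "i < length is" for i
    proof -
      have "(i + 1) mod length is < length is" using i by (intro mod_less_divisor) linarith
      then have "is ! i < m + 2" "is ! ((i + 1) mod length is) < m + 2"
        using "is"(4) i nth_mem by blast+
      then show ?thesis by (simp add: edge[OF i] edge_weight_pair \<sigma>(2))
    qed
    then have "(\<Sum>i<length ?vs. edge_weight m \<sigma> (cycle_edge ?vs i)) = real m"
      using "is"(5) by (simp flip: of_nat_sum)
    then have "(\<Sum>i<length ?vs. a (cycle_edge ?vs i)) = 0"
      using tight[OF cyc(1)] cyc(2) by simp
    then show ?thesis by (simp add: edge b_def)
  qed
  have "b i j = 0" if "i \<noteq> j" "i < m + 2" "j < m + 2" for i j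
  proof (rule tight_function_zero[OF m _ _ _ that])
    show "b i j = b j i" for i j by (simp add: b_def insert_commute)
    show "b i j + b j k + b k i = 0"
      if "distinct [i, j, k]" "{i, j, k} \<subseteq> {..<m + 2}"
        "pair_weight m i j + pair_weight m j k + pair_weight m k i = m" for i j k
      using relabelled[of "[i, j, k]"] that by simp
    show "b i j + b j k + b k l + b l r + b r i = 0"
      if "distinct [i, j, k, l, r]" "{i, j, k, l, r} \<subseteq> {..<m + 2}"
        "pair_weight m i j + pair_weight m j k + pair_weight m k l + pair_weight m l r
          + pair_weight m r i = m" for i j k l r
      using relabelled[of "[i, j, k, l, r]"] that by simp
  qed
  moreover obtain u v where "e = {u, v}" "u \<noteq> v" "u < m + 2" "v < m + 2"
    using e by (auto simp: complete_edges_def)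
  moreover have "a {u, v} = b (\<sigma> u) (\<sigma> v)" using calculation \<sigma>(2) by (simp add: b_def)
  ultimately show "a e = 0" using \<sigma>(1) \<sigma>_eq_iff by simp
qed

section \<open>Exponentially many relabellings\<close>

text \<open>The last vertex of each triple stays fixed as a reference: its edge to the middle vertex
  reveals whether the triple was swapped.\<close>

definition block_swap :: "nat set \<Rightarrow> nat \<Rightarrow> nat" where
  "block_swap S u =
     (if u div 3 \<in> S then (if u mod 3 = 0 then u + 1 else if u mod 3 = 1 then u - 1 else u) else u)"

lemma block_swap_involution: "block_swap S (block_swap S u) = u"
proof -
  have "(u + 1) div 3 = u div 3 \<and> (u + 1) mod 3 = 1" if "u mod 3 = 0"
    using that by presburger
  moreover have "(u - 1) div 3 = u div 3 \<and> (u - 1) mod 3 = 0 \<and> u - 1 + 1 = u" if "u mod 3 = 1"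
    using that by presburger
  ultimately show ?thesis by (auto simp: block_swap_def)
qed

lemma block_swap_less:
  assumes "S \<subseteq> {..<k}" "3 * k \<le> n" "u < n"
  shows "block_swap S u < n"
proof -
  have "u + 1 < n" if "u div 3 < k" "u mod 3 = 0" using assms that by presburger
  then show ?thesis using assms by (auto simp: block_swap_def)
qed

text \<open>After a swap the endpoints carry the labels \<open>3 * i\<close> and
  \<open>3 * i + 2\<close>, whose odd arc has length \<open>m - 2\<close>; otherwise they are
  neighbours on the cycle.\<close>

lemma edge_weight_block_swap:
  assumes "odd m" "3 * k \<le> m" "i < k"
  shows "edge_weight m (block_swap S) {3 * i + 1, 3 * i + 2} = (if i \<in> S then real m - 2 else 1)"
proof -
  have "(3 * i + 1) div 3 = i" "(3 * i + 2) div 3 = i" "(3 * i + 1) mod 3 = 1" "(3 * i + 2) mod 3 = 2"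
    by presburger+
  then show ?thesis
    using assms by (simp add: edge_weight_pair block_swap_def pair_weight_def of_nat_diff)
qed

lemma tight_weight_block_swap:
  assumes "odd m" "m \<ge> 5" "S \<subseteq> {..<m div 3}"
  shows "tight_weight (complete_edges (m + 2)) (edge_weight m (block_swap S)) (real m)"
  using assms block_swap_less[of S "m div 3" "m + 2"]
  by (intro tight_weight_edge_weight) (auto simp: block_swap_involution)

definition swap_facet :: "nat \<Rightarrow> nat set \<Rightarrow> (nat set \<Rightarrow> real) set" where
  "swap_facet m S = tight_weight.facet (complete_edges (m + 2)) (edge_weight m (block_swap S)) (real m)"

lemma inj_on_swap_facet:
  assumes m: "odd m" "m \<ge> 5"
  shows "inj_on (swap_facet m) (Pow {..<m div 3})"
proof (rule inj_onI)
  fix S S' assume S: "S \<in> Pow {..<m div 3}" "S' \<in> Pow {..<m div 3}"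
    and eq: "swap_facet m S = swap_facet m S'"
  interpret A: tight_weight "complete_edges (m + 2)" "edge_weight m (block_swap S)" "real m"
    using tight_weight_block_swap m S by blast
  interpret B: tight_weight "complete_edges (m + 2)" "edge_weight m (block_swap S')" "real m"
    using tight_weight_block_swap m S by blast
  have weq: "edge_weight m (block_swap S') e = edge_weight m (block_swap S) e"
    if "e \<in> complete_edges (m + 2)" for e
  proof -
    have "(\<Sum>e\<in>complete_edges (m + 2). edge_weight m (block_swap S') e * x e) = real m"
      if "x \<in> A.facet" for x
    proof -
      have "x \<in> B.facet" using that eq by (simp only: swap_facet_def)
      then show ?thesis unfolding B.facet_def by blast
    qed
    \<comment> \<open>Both equations have right-hand side \<open>m\<close>, so the proportionality
      factor is 1.\<close>
    from A.facet_equation_proportional[OF this that] show ?thesis using m by simp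
  qed
  have "i \<in> S \<longleftrightarrow> i \<in> S'" if i: "i < m div 3" for i
  proof -
    have "{3 * i + 1, 3 * i + 2} \<in> complete_edges (m + 2)"
      unfolding complete_edges_iff using i by presburger
    from weq[OF this] show ?thesis
      using edge_weight_block_swap[of m "m div 3" i] i m by (simp split: if_splits)
  qed
  then show "S = S'" using S by blast
qed

section \<open>Integral equations and the exponential count\<close>

text \<open>The coefficients are a nonzero multiple \<mu> of the weights. Weight 1 occurs, so
  integrality gives absolute value at least 1 for \<mu>, and the weights 1, 3, ...,
  \<open>m - 2\<close> supply both bounds.\<close>

lemma swap_facet_coefficients:
  fixes a :: "nat set \<Rightarrow> int" and b :: int
  assumes m: "odd m" "m \<ge> 5" and S: "S \<subseteq> {..<m div 3}"
    and eq: "swap_facet m S = {x \<in> odd_cycle_dominant (complete_edges (m + 2)).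
      (\<Sum>e\<in>complete_edges (m + 2). real_of_int (a e) * x e) = real_of_int b}"
  shows "real_of_int (Max ((\<lambda>e. \<bar>a e\<bar>) ` complete_edges (m + 2))) \<ge> real m - 2"
    and "real (card (a ` complete_edges (m + 2))) \<ge> (real m - 1) / 2"
proof -
  let ?E = "complete_edges (m + 2)" and ?\<sigma> = "block_swap S"
  interpret tight_weight ?E "edge_weight m ?\<sigma>" "real m"
    using tight_weight_block_swap m S by blast
  obtain \<mu> where \<mu>: "\<mu> \<noteq> 0" "\<And>e. e \<in> ?E \<Longrightarrow> real_of_int (a e) = \<mu> * edge_weight m ?\<sigma> e"
    using facet_equation_multiple[OF eq[unfolded swap_facet_def]] by blast
  have "\<exists>e\<in>?E. real_of_int (a e) = \<mu> * real (2 * t + 1)" if t: "2 * t + 1 < m" for t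
  proof
    \<comment> \<open>Since \<open>?\<sigma>\<close> is an involution, these endpoints carry the
      labels 0 and \<open>2 * t + 1\<close>.\<close>
    let ?e = "{?\<sigma> 0, ?\<sigma> (2 * t + 1)}"
    have "?\<sigma> 0 \<noteq> ?\<sigma> (2 * t + 1)" using block_swap_involution by (metis add_is_0 one_neq_zero)
    moreover have "?\<sigma> 0 < m + 2" "?\<sigma> (2 * t + 1) < m + 2"
      using block_swap_less[OF S, of "m + 2"] t by auto
    ultimately show "?e \<in> ?E" by (simp add: complete_edges_iff)
    from \<mu>(2)[OF this] show "real_of_int (a ?e) = \<mu> * real (2 * t + 1)"
      using t by (simp add: edge_weight_pair block_swap_involution pair_weight_def)
  qed
  then obtain g where g: "\<And>t. 2 * t + 1 < m \<Longrightarrow> g t \<in> ?E"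
      "\<And>t. 2 * t + 1 < m \<Longrightarrow> real_of_int (a (g t)) = \<mu> * real (2 * t + 1)"
    by metis
  obtain q where q: "m = 2 * q + 1" "q \<ge> 2" using m by (auto elim!: oddE)
  have "real_of_int \<bar>a (g 0)\<bar> = \<bar>\<mu>\<bar>" using g(2)[of 0] m by simp
  moreover from this have "\<bar>a (g 0)\<bar> \<ge> 1" using \<mu>(1) by linarith
  ultimately have "\<bar>\<mu>\<bar> \<ge> 1" by linarith
  have "real m - 2 = real (2 * (q - 1) + 1)" using q by (simp add: of_nat_diff)
  also have "\<dots> \<le> \<bar>\<mu>\<bar> * real (2 * (q - 1) + 1)"
    using mult_right_mono[OF \<open>\<bar>\<mu>\<bar> \<ge> 1\<close>, of "real (2 * (q - 1) + 1)"] by simp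
  also have "\<dots> = real_of_int \<bar>a (g (q - 1))\<bar>"
    using g(2)[of "q - 1"] q by (simp add: abs_mult)
  also have "\<dots> \<le> real_of_int (Max ((\<lambda>e. \<bar>a e\<bar>) ` ?E))"
    using g(1)[of "q - 1"] q finite_complete_edges by (intro of_int_le_iff[THEN iffD2] Max_ge) auto
  finally show "real_of_int (Max ((\<lambda>e. \<bar>a e\<bar>) ` ?E)) \<ge> real m - 2" .
  have "inj_on (\<lambda>t. a (g t)) {..<q}"
  proof (rule inj_onI)
    fix t t' assume "t \<in> {..<q}" "t' \<in> {..<q}" "a (g t) = a (g t')"
    then have "\<mu> * real (2 * t + 1) = \<mu> * real (2 * t' + 1)"
      using g(2)[of t, symmetric] g(2)[of t', symmetric] q by (simp only: lessThan_iff)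
    then show "t = t'" using \<mu>(1) by simp
  qed
  then have "card {..<q} \<le> card (a ` ?E)"
    using g(1) q finite_complete_edges by (intro card_inj_on_le) auto
  then show "real (card (a ` ?E)) \<ge> (real m - 1) / 2" using q by simp
qed

lemma exponential_bound:
  assumes "n \<ge> 7"
  shows "(11 / 10 :: real) ^ n \<le> 2 ^ ((n - 2) div 3)"
proof -
  define q where "q = (n - 2) div 3"
  have q: "n \<le> 3 * q + 4" "q \<ge> 1" using assms by (auto simp: q_def)
  then obtain q' where q': "q = Suc q'" by (cases q) auto
  have "(11 / 10 :: real) ^ n \<le> (11 / 10) ^ (3 * q + 4)"
    using q by (intro power_increasing) auto
  \<comment> \<open>With \<open>q = Suc q'\<close> the exponent is \<open>3 * q' + 7\<close>; the
    base 11/10 works because both its third and its seventh power are below 2.\<close>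
  also have "\<dots> = (11 / 10) ^ 7 * ((11 / 10) ^ 3) ^ q'"
    by (simp add: q' power_add flip: power_mult)
  also have "\<dots> \<le> 2 * 2 ^ q'"
    by (intro mult_mono power_mono) (auto simp: power_divide)
  finally show ?thesis by (simp add: q' flip: q_def)
qed

theorem theorem4:
  "\<exists>c::real. c > 1 \<and> (\<exists>N::nat. \<forall>n::nat. odd n \<and> n > 0 \<longrightarrow>
     (\<exists>E \<F>. simple_graph n E \<and>
        (\<forall>F\<in>\<F>. facet_E E (odd_cycle_dominant E) F) \<and>
        (n \<ge> N \<longrightarrow> real (card \<F>) \<ge> c ^ n) \<and>
        (\<forall>F\<in>\<F>. \<forall>(a::nat set \<Rightarrow> int) (b::int).
            F = {x\<in>odd_cycle_dominant E. (\<Sum>e\<in>E. real_of_int (a e) * x e) = real_of_int b} \<longrightarrow>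
              real_of_int (Max ((\<lambda>e. \<bar>a e\<bar>) ` E)) \<ge> real n - 4 \<and>
              real (card (a ` E)) \<ge> (real n - 3) / 2)))"
\<comment> \<open>The threshold 7 is where \<open>n - 2\<close> reaches 5, the least cycle length
  treated by the construction.\<close>
proof (intro exI[of _ "11 / 10"] conjI exI[of _ 7] allI impI)
  fix n :: nat assume n: "odd n \<and> n > 0"
  show "\<exists>E \<F>. simple_graph n E \<and>
        (\<forall>F\<in>\<F>. facet_E E (odd_cycle_dominant E) F) \<and>
        (n \<ge> 7 \<longrightarrow> real (card \<F>) \<ge> (11 / 10) ^ n) \<and>
        (\<forall>F\<in>\<F>. \<forall>(a::nat set \<Rightarrow> int) (b::int).
            F = {x\<in>odd_cycle_dominant E. (\<Sum>e\<in>E. real_of_int (a e) * x e) = real_of_int b} \<longrightarrow>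
              real_of_int (Max ((\<lambda>e. \<bar>a e\<bar>) ` E)) \<ge> real n - 4 \<and>
              real (card (a ` E)) \<ge> (real n - 3) / 2)"
  proof (cases "n \<ge> 7")
    case False
    \<comment> \<open>Below the threshold no size is demanded, so the empty family on the edgeless
      graph serves.\<close>
    then show ?thesis by (intro exI[of _ "{}"]) (auto simp: simple_graph_def)
  next
    case True
    define m where "m = n - 2"
    have m: "odd m" "m \<ge> 5" "n = m + 2" using n True by (auto simp: m_def)
    let ?\<F> = "swap_facet m ` Pow {..<m div 3}"
    have "facet_E (complete_edges n) (odd_cycle_dominant (complete_edges n)) (swap_facet m S)"
      if "S \<subseteq> {..<m div 3}" for S
      using tight_weight.facet_E_facet[OF tight_weight_block_swap[OF m(1,2) that]]
      by (simp add: swap_facet_def m(3))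
    moreover have "real (card ?\<F>) \<ge> (11 / 10) ^ n"
      using exponential_bound[OF True] m(3)
      by (simp add: card_image[OF inj_on_swap_facet[OF m(1,2)]] card_Pow)
    moreover have "real_of_int (Max ((\<lambda>e. \<bar>a e\<bar>) ` complete_edges n)) \<ge> real n - 4 \<and>
        real (card (a ` complete_edges n)) \<ge> (real n - 3) / 2"
      if "S \<subseteq> {..<m div 3}" and "swap_facet m S = {x\<in>odd_cycle_dominant (complete_edges n).
          (\<Sum>e\<in>complete_edges n. real_of_int (a e) * x e) = real_of_int b}"
      for S and a :: "nat set \<Rightarrow> int" and b :: int
      using swap_facet_coefficients[OF m(1,2) that(1), of a b] that(2) by (simp add: m(3))
    ultimately show ?thesis
      by (intro exI[of _ "complete_edges n"] exI[of _ ?\<F>])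
        (auto simp: simple_graph_def complete_edges_def)
  qed
qed simp

end
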